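(* Let $\Omega\subset\mathbb{R}^n$ be open and let $u,f,g\in C(\Omega)$. Suppose $u$ is simultaneously a viscosity solution of $\Delta_\infty u=f(x)$ in $\Omega$ and of $\Delta_\infty u=g(x)$ in $\Omega$. Then $f=g$ in $\Omega$.
   Context: $\Delta_\infty u=\sum_{i,j}u_{x_i}u_{x_j}u_{x_ix_j}=Du\cdot D^2u\cdot Du$ is the infinity Laplacian. A continuous $u$ is a viscosity subsolution of $\Delta_\infty u=h$ in $\Omega$ if whenever $\phi\in C^2(\Omega)$ and $u-\phi$ has a local maximum at $x_0\in\Omega$, then $D\phi(x_0)\cdot D^2\phi(x_0)\cdot D\phi(x_0)\ge h(x_0)$; a viscosity supersolution if whenever $u-\phi$ has a local minimum at $x_0$, then $D\phi(x_0)\cdot D^2\phi(x_0)\cdot D\phi(x_0)\le h(x_0)$; a viscosity solution if both. No a priori Lipschitz regularity of $u$ is assumed. *)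

theory Defs
  imports "HOL-Analysis.Analysis"
begin

definition C2_with :: "(real^('n::finite)) set \<Rightarrow> (real^'n \<Rightarrow> real) \<Rightarrow> (real^'n \<Rightarrow> real^'n)
    \<Rightarrow> (real^'n \<Rightarrow> real^'n^'n) \<Rightarrow> bool" where
  "C2_with \<Omega> \<phi> D\<phi> H\<phi> \<longleftrightarrow>
     (\<forall>x\<in>\<Omega>. (\<phi> has_derivative (\<lambda>h. D\<phi> x \<bullet> h)) (at x)) \<and>
     (\<forall>x\<in>\<Omega>. (D\<phi> has_derivative (\<lambda>h. H\<phi> x *v h)) (at x)) \<and>
     continuous_on \<Omega> H\<phi>"

definition inf_lap :: "real^'n \<Rightarrow> real^'n^'n \<Rightarrow> real" where
  "inf_lap p X = p \<bullet> (X *v p)"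

definition local_max_at :: "(real^'n) set \<Rightarrow> (real^'n \<Rightarrow> real) \<Rightarrow> real^'n \<Rightarrow> bool" where
  "local_max_at \<Omega> w x0 \<longleftrightarrow> (\<exists>r>0. \<forall>y\<in>\<Omega> \<inter> ball x0 r. w y \<le> w x0)"

definition local_min_at :: "(real^'n) set \<Rightarrow> (real^'n \<Rightarrow> real) \<Rightarrow> real^'n \<Rightarrow> bool" where
  "local_min_at \<Omega> w x0 \<longleftrightarrow> (\<exists>r>0. \<forall>y\<in>\<Omega> \<inter> ball x0 r. w x0 \<le> w y)"

definition inf_visc_subsol :: "(real^'n) set \<Rightarrow> (real^'n \<Rightarrow> real) \<Rightarrow> (real^'n \<Rightarrow> real) \<Rightarrow> bool" where
  "inf_visc_subsol \<Omega> u h \<longleftrightarrow> continuous_on \<Omega> u \<and>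
     (\<forall>\<phi> D\<phi> H\<phi> x0. C2_with \<Omega> \<phi> D\<phi> H\<phi> \<and> x0 \<in> \<Omega> \<and> local_max_at \<Omega> (\<lambda>x. u x - \<phi> x) x0
        \<longrightarrow> inf_lap (D\<phi> x0) (H\<phi> x0) \<ge> h x0)"

definition inf_visc_supersol :: "(real^'n) set \<Rightarrow> (real^'n \<Rightarrow> real) \<Rightarrow> (real^'n \<Rightarrow> real) \<Rightarrow> bool" where
  "inf_visc_supersol \<Omega> u h \<longleftrightarrow> continuous_on \<Omega> u \<and>
     (\<forall>\<phi> D\<phi> H\<phi> x0. C2_with \<Omega> \<phi> D\<phi> H\<phi> \<and> x0 \<in> \<Omega> \<and> local_min_at \<Omega> (\<lambda>x. u x - \<phi> x) x0
        \<longrightarrow> inf_lap (D\<phi> x0) (H\<phi> x0) \<le> h x0)"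

definition inf_visc_sol :: "(real^'n) set \<Rightarrow> (real^'n \<Rightarrow> real) \<Rightarrow> (real^'n \<Rightarrow> real) \<Rightarrow> bool" where
  "inf_visc_sol \<Omega> u h \<longleftrightarrow> inf_visc_subsol \<Omega> u h \<and> inf_visc_supersol \<Omega> u h"

end

theory Submission
  imports Defs
begin

text \<open>If \<open>f < g\<close> at some point, then, possibly after replacing \<open>u\<close> by \<open>- u\<close>, there are constants
  \<open>0 < a < b\<close> such that \<open>u\<close> is on a small open set both a subsolution with right-hand side \<open>b\<close> and a
  supersolution with right-hand side \<open>a\<close>.  Write \<open>L x\<close> for the local Lipschitz constant of \<open>u\<close>, the
  substitute for the norm of the gradient.  Comparison with radial quadratic functions shows that a
  step of length \<open>s\<close> to the largest value of \<open>u\<close> on a sphere raises \<open>L\<close> by almost \<open>b s / L\<^sup>2\<close>, while a step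
  to the smallest value lowers \<open>L\<close> by hardly more than \<open>a s / L\<^sup>2\<close>.  Going up and then down therefore
  raises \<open>L\<close> by a fixed multiple of \<open>s\<close>.  Start at a maximum point \<open>x\<close> of \<open>L - K dist(\<cdot>, c)\<close>.
  Upper semicontinuity of \<open>L\<close> bounds the Lipschitz constant near \<open>x\<close> by \<open>L x + o(1)\<close>, so by the
  parallelogram law the two steps almost cancel and lead to a point at distance \<open>o(s)\<close> from \<open>x\<close>, where
  maximality only allows a growth of \<open>L\<close> by \<open>o(s)\<close>.\<close>

section \<open>Local Lipschitz constants\<close>

text \<open>The one-sided difference controls the absolute value, since \<open>x\<close> and
  \<open>y\<close> range over the same ball. The condition \<open>K \<ge> 0\<close> bounds the set
  below even at an isolated point.\<close>

definition lip_consts :: "('a::metric_space \<Rightarrow> real) \<Rightarrow> 'a \<Rightarrow> real set" where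
  "lip_consts u z = {K. K \<ge> 0 \<and> (\<exists>r>0. \<forall>x\<in>ball z r. \<forall>y\<in>ball z r. u x - u y \<le> K * dist x y)}"

definition local_lip :: "('a::metric_space \<Rightarrow> real) \<Rightarrow> 'a \<Rightarrow> real" where
  "local_lip u z = Inf (lip_consts u z)"

lemma lip_consts_uminus: "lip_consts (\<lambda>x. - u x) z = lip_consts u z"
proof -
  have "lip_consts u z \<subseteq> lip_consts (\<lambda>x. - u x) z" for u :: "'a \<Rightarrow> real"
    unfolding lip_consts_def by (auto simp: dist_commute) (metis dist_commute)
  from this[of u] this[of "\<lambda>x. - u x"] show ?thesis
    by auto
qed

lemma local_lip_uminus: "local_lip (\<lambda>x. - u x) = local_lip u"
  by (simp add: local_lip_def lip_consts_uminus fun_eq_iff)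

lemma bdd_below_lip_consts: "bdd_below (lip_consts u z)"
  by (rule bdd_belowI[of _ 0]) (auto simp: lip_consts_def)

lemma local_lip_le: "K \<in> lip_consts u z \<Longrightarrow> local_lip u z \<le> K"
  unfolding local_lip_def by (rule cInf_lower[OF _ bdd_below_lip_consts])

lemma local_lip_ge:
  assumes "lip_consts u z \<noteq> {}" "\<And>K. K \<in> lip_consts u z \<Longrightarrow> m \<le> K"
  shows "m \<le> local_lip u z"
  unfolding local_lip_def using assms by (rule cInf_greatest)

lemma local_lip_nonneg: "lip_consts u z \<noteq> {} \<Longrightarrow> 0 \<le> local_lip u z"
  by (rule local_lip_ge) (auto simp: lip_consts_def)

lemma local_lip_less_obtain:
  assumes "lip_consts u z \<noteq> {}" "local_lip u z < K"
  obtains r where "r > 0" "\<And>x y. x \<in> ball z r \<Longrightarrow> y \<in> ball z r \<Longrightarrow> u x - u y \<le> K * dist x y"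
proof -
  obtain k where k: "k \<in> lip_consts u z" "k < K"
    using assms bdd_below_lip_consts[of u z] unfolding local_lip_def
    by (meson cInf_less_iff)
  then obtain r where r: "r > 0" "\<forall>x\<in>ball z r. \<forall>y\<in>ball z r. u x - u y \<le> k * dist x y"
    by (auto simp: lip_consts_def)
  show ?thesis
  proof (rule that[OF r(1)])
    fix x y assume "x \<in> ball z r" "y \<in> ball z r"
    then have "u x - u y \<le> k * dist x y"
      using r(2) by blast
    also have "\<dots> \<le> K * dist x y"
      using k(2) by (intro mult_right_mono) auto
    finally show "u x - u y \<le> K * dist x y" .
  qed
qed

text \<open>A Lipschitz constant valid on a ball about \<open>z\<close> is valid on a smaller ball
  about each of its points; the intermediate \<open>k\<close> keeps the inequality strict.\<close>

lemma local_lip_upper_semicontinuous: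
  assumes "lip_consts u z \<noteq> {}" "local_lip u z < K"
  shows "\<forall>\<^sub>F y in nhds z. local_lip u y < K"
proof -
  define k where "k = (local_lip u z + K) / 2"
  have k: "local_lip u z < k" "k < K"
    using assms(2) by (auto simp: k_def)
  have k0: "k \<ge> 0"
    using local_lip_nonneg[OF assms(1)] k(1) by linarith
  obtain r where r: "r > 0" "\<And>x y. x \<in> ball z r \<Longrightarrow> y \<in> ball z r \<Longrightarrow> u x - u y \<le> k * dist x y"
    using local_lip_less_obtain[OF assms(1) k(1)] by metis
  have "local_lip u y < K" if y: "y \<in> ball z r" for y
  proof -
    obtain e where e: "e > 0" "ball y e \<subseteq> ball z r"
      using y open_ball open_contains_ball by blast
    then have "k \<in> lip_consts u y"
      using r(2) k0 unfolding lip_consts_def by blast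
    then show ?thesis
      using local_lip_le k(2) by fastforce
  qed
  then show ?thesis
    using eventually_nhds_in_open[of "ball z r" z] r(1) by (auto elim!: eventually_mono)
qed

text \<open>Without a maximum, every point has a neighbourhood on which \<open>G\<close> stays below
  some value \<open>G (Y z)\<close> attained in \<open>S\<close>. In a finite subcover, the point
  carrying the largest of these values lies in one of the neighbourhoods and is strictly
  beaten.\<close>

lemma upper_semicontinuous_attains_sup:
  fixes G :: "'a::topological_space \<Rightarrow> real"
  assumes "compact S" "S \<noteq> {}"
    and usc: "\<And>z c. z \<in> S \<Longrightarrow> G z < c \<Longrightarrow> \<forall>\<^sub>F y in nhds z. G y < c"
  shows "\<exists>x\<in>S. \<forall>y\<in>S. G y \<le> G x"
proof (rule ccontr)
  assume neg: "\<not> ?thesis"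
  have "\<exists>T y. open T \<and> z \<in> T \<and> y \<in> S \<and> (\<forall>x\<in>T. G x < G y)" if z: "z \<in> S" for z
  proof -
    obtain y where y: "y \<in> S" "G z < G y"
      using neg z by fastforce
    show ?thesis
      using usc[OF z y(2)] y(1) unfolding eventually_nhds by blast
  qed
  then obtain T Y where TY: "\<And>z. z \<in> S \<Longrightarrow> open (T z) \<and> z \<in> T z \<and> Y z \<in> S \<and> (\<forall>x\<in>T z. G x < G (Y z))"
    by metis
  obtain F where F: "F \<subseteq> S" "finite F" "S \<subseteq> (\<Union>z\<in>F. T z)"
    using compactE_image[OF assms(1), of S T] TY by blast
  have "F \<noteq> {}"
    using F assms(2) by auto
  obtain m where m: "m \<in> F" "G (Y m) = Max ((\<lambda>z. G (Y z)) ` F)"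
    using Max_in[of "(\<lambda>z. G (Y z)) ` F"] F(2) \<open>F \<noteq> {}\<close> by fastforce
  have "Y m \<in> S"
    using m F TY by blast
  then obtain z where "z \<in> F" "Y m \<in> T z"
    using F by blast
  then have "G (Y m) < G (Y z)"
    using TY[of z] F(1) by blast
  moreover have "G (Y z) \<le> G (Y m)"
    using m(2) F(2) \<open>z \<in> F\<close> by simp
  ultimately show False
    by linarith
qed

section \<open>Comparison with radial quadratic functions\<close>

text \<open>A viscosity inequality tested only with quadratic radial profiles, expanded at the
  contact radius: \<open>p\<close> and \<open>q\<close> are the first and second radial derivatives
  there, and a radial function has infinity Laplacian \<open>q * p\<^sup>2\<close>. The centre is
  excluded because the distance is singular there.\<close>

definition radial_subsol :: "'a::euclidean_space set \<Rightarrow> ('a \<Rightarrow> real) \<Rightarrow> real \<Rightarrow> bool" where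
  "radial_subsol B u c \<longleftrightarrow> continuous_on B u \<and>
     (\<forall>z p q. \<forall>x\<in>B - {z}.
        (\<forall>\<^sub>F y in nhds x. u y \<le> u x + p * (dist y z - dist x z) + q / 2 * (dist y z - dist x z)\<^sup>2)
        \<longrightarrow> c \<le> q * p\<^sup>2)"

text \<open>The quadratic is a strict supersolution off the centre, so \<open>u\<close> minus the
  quadratic has its maximum over the ball at \<open>z\<close> or on the sphere, where it is at most
  \<open>u z\<close>.\<close>

lemma radial_comparison:
  assumes sub: "radial_subsol B u c" and "cball z R \<subseteq> B" and "R > 0"
    and strict: "\<And>r. 0 < r \<Longrightarrow> r < R \<Longrightarrow> q * (p + q * r)\<^sup>2 < c"
    and bd: "\<And>x. x \<in> sphere z R \<Longrightarrow> u x \<le> u z + p * R + q / 2 * R\<^sup>2"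
    and x: "x \<in> cball z R"
  shows "u x \<le> u z + p * dist x z + q / 2 * (dist x z)\<^sup>2"
proof -
  define w where "w x = u x - (p * dist x z + q / 2 * (dist x z)\<^sup>2)" for x
  have "continuous_on (cball z R) u"
    using sub assms(2) continuous_on_subset unfolding radial_subsol_def by blast
  then have "continuous_on (cball z R) w"
    unfolding w_def by (intro continuous_intros)
  then obtain m where m: "m \<in> cball z R" "\<And>y. y \<in> cball z R \<Longrightarrow> w y \<le> w m"
    using continuous_attains_sup[of "cball z R" w] \<open>R > 0\<close> by auto
  have "w m \<le> u z"
  proof (cases "m = z \<or> m \<in> sphere z R")
    case True
    then show ?thesis
      using bd[of m] by (auto simp: w_def dist_commute)
  next
    case False
    then have r: "0 < dist m z" "dist m z < R" "m \<in> ball z R"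
      using m(1) by (auto simp: dist_commute)
    have "\<forall>\<^sub>F y in nhds m. y \<in> ball z R"
      using r(3) by (intro eventually_nhds_in_open) auto
    \<comment> \<open>Re-expanding the quadratic at the radius of \<open>m\<close> turns the slope
      \<open>p\<close> into \<open>p + q * dist m z\<close>.\<close>
    then have "\<forall>\<^sub>F y in nhds m. u y \<le> u m + (p + q * dist m z) * (dist y z - dist m z)
                 + q / 2 * (dist y z - dist m z)\<^sup>2"
    proof eventually_elim
      case (elim y)
      then have "w y \<le> w m"
        using m(2)[of y] by auto
      then show ?case
        by (simp add: w_def power2_eq_square algebra_simps)
    qed
    then have "c \<le> q * (p + q * dist m z)\<^sup>2"
      using sub m(1) assms(2) r(1) unfolding radial_subsol_def by fastforce
    then show ?thesis
      using strict[OF r(1,2)] by linarith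
  qed
  then show ?thesis
    using m(2)[OF x] by (auto simp: w_def)
qed

text \<open>The quadratic with second derivative \<open>q\<close> and mean slope \<sigma> over
  radius \<open>R\<close> has slope \<open>\<sigma> - q * R / 2\<close> at its centre. Comparison
  about every centre near \<open>z\<close> turns this into a Lipschitz bound; \<kappa> and
  \<open>e\<close> pay for moving the centre.\<close>

lemma lip_consts_radial:
  fixes u :: "'a::euclidean_space \<Rightarrow> real"
  assumes sub: "radial_subsol B u c" and B: "open B" "cball z R \<subseteq> B" and "R > 0"
    and "\<kappa> > 0" and strict: "\<And>t. \<bar>t - \<sigma>\<bar> \<le> \<bar>q\<bar> * R / 2 + \<kappa> \<Longrightarrow> q * t\<^sup>2 < c"
    and bd: "\<And>x. x \<in> sphere z R \<Longrightarrow> u x \<le> u z + \<sigma> * R"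
    and "e > 0"
  shows "\<sigma> - q * R / 2 + e \<in> lip_consts u z"
proof -
  define d where "d = min \<kappa> (e / 2)"
  have d: "d > 0" "d \<le> \<kappa>" "d \<le> e / 2"
    using assms(5,8) by (auto simp: d_def)
  \<comment> \<open>Chosen so that the profile equals \<open>(\<sigma> + d) * R\<close> at radius
    \<open>R\<close>.\<close>
  define p where "p = \<sigma> + d - q * R / 2"
  \<comment> \<open>Spheres about nearby centres leave \<open>cball z R\<close>, so a slightly
    larger closed ball inside \<open>B\<close> is needed.\<close>
  obtain \<eta> where \<eta>: "\<eta> > 0" "cball z (R + \<eta>) \<subseteq> B"
  proof -
    obtain \<eta> where "\<eta> > 0" "{x. infdist x (cball z R) \<le> \<eta>} \<subseteq> B"
      using compact_in_open_separated[of "cball z R" B] B \<open>R > 0\<close> by auto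
    moreover have "infdist x (cball z R) \<le> \<eta>" if "x \<in> cball z (R + \<eta>)" for x
    proof (cases "x \<in> cball z R")
      case True
      then show ?thesis using \<open>\<eta> > 0\<close> by simp
    next
      case False
      then have n: "R < dist z x" by auto
      define y where "y = z + (R / dist z x) *\<^sub>R (x - z)"
      have "y \<in> cball z R"
        using n \<open>R > 0\<close> by (auto simp: y_def dist_norm norm_minus_commute)
      moreover have "dist x y \<le> \<eta>"
      proof -
        have "x - y = (1 - R / dist z x) *\<^sub>R (x - z)"
          by (simp add: y_def algebra_simps)
        then have "dist x y = \<bar>1 - R / dist z x\<bar> * dist z x"
          by (simp add: dist_norm norm_minus_commute)
        also have "\<bar>1 - R / dist z x\<bar> = 1 - R / dist z x"
          using n \<open>R > 0\<close> by (intro abs_of_nonneg) (auto simp: divide_le_eq)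
        also have "(1 - R / dist z x) * dist z x = dist z x - R"
          using n \<open>R > 0\<close> by (auto simp: left_diff_distrib)
        finally show ?thesis
          using that by simp
      qed
      ultimately show ?thesis
        by (meson infdist_le2)
    qed
    ultimately show ?thesis
      using that by blast
  qed
  have "continuous_on (cball z (R + \<eta>)) u"
    using sub \<eta>(2) continuous_on_subset unfolding radial_subsol_def by blast
  then have "uniformly_continuous_on (cball z (R + \<eta>)) u"
    by (rule compact_uniformly_continuous) simp
  moreover have "d * R / 2 > 0"
    using d(1) \<open>R > 0\<close> by simp
  ultimately obtain \<delta> where \<delta>: "\<delta> > 0"
      "\<And>x y. x \<in> cball z (R + \<eta>) \<Longrightarrow> y \<in> cball z (R + \<eta>) \<Longrightarrow> dist x y < \<delta> \<Longrightarrow> dist (u x) (u y) < d * R / 2"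
    by (rule uniformly_continuous_onE) blast
  \<comment> \<open>In order: moved spheres stay in the larger ball, uniform continuity applies, two
    points of \<open>ball z s\<close> have distance below \<open>R\<close>, and the quadratic term
    costs at most \<open>e / 2\<close>.\<close>
  define s where "s = Min {\<eta>, \<delta>, R / 2, e / (2 * \<bar>q\<bar> + 2)}"
  have s: "s > 0" "s \<le> \<eta>" "s \<le> \<delta>" "s \<le> R / 2" "s \<le> e / (2 * \<bar>q\<bar> + 2)"
  proof -
    show "s > 0"
      using \<eta>(1) \<delta>(1) \<open>R > 0\<close> \<open>e > 0\<close> by (auto simp: s_def)
  qed (unfold s_def, (rule Min_le; simp)+)
  have qs: "\<bar>q\<bar> * s \<le> e / 2"
  proof -
    have "\<bar>q\<bar> * s \<le> (\<bar>q\<bar> + 1) * s"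
      using s(1) by simp
    also have "\<dots> \<le> e / 2"
      using s(5) by (simp add: field_simps)
    finally show ?thesis .
  qed
  have lip: "u x - u y \<le> (\<sigma> - q * R / 2 + e) * dist x y" if x: "x \<in> ball z s" and y: "y \<in> ball z s" for x y
  proof -
    have sub_cball: "cball y R \<subseteq> cball z (R + \<eta>)"
      using y s(2) by (auto intro!: cball_subset_cball_iff[THEN iffD2] simp: dist_commute)
    have "u x \<le> u y + p * dist x y + q / 2 * (dist x y)\<^sup>2"
    proof (rule radial_comparison[OF sub _ \<open>R > 0\<close>])
      show "cball y R \<subseteq> B"
        using sub_cball \<eta>(2) by blast
      show "x \<in> cball y R"
        using x y s(4) dist_triangle[of y x z] by (auto simp: dist_commute)
      show "q * (p + q * r)\<^sup>2 < c" if "0 < r" "r < R" for r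
      proof (rule strict)
        have "\<bar>p + q * r - \<sigma>\<bar> = \<bar>d + q * (r - R / 2)\<bar>"
          by (simp add: p_def algebra_simps)
        also have "\<dots> \<le> d + \<bar>q\<bar> * \<bar>r - R / 2\<bar>"
          using d(1) abs_triangle_ineq[of d "q * (r - R / 2)"] by (simp add: abs_mult)
        also have "\<dots> \<le> \<kappa> + \<bar>q\<bar> * (R / 2)"
          using d(2) that by (intro add_mono mult_left_mono) linarith+
        finally show "\<bar>p + q * r - \<sigma>\<bar> \<le> \<bar>q\<bar> * R / 2 + \<kappa>"
          by simp
      qed
      show "u x' \<le> u y + p * R + q / 2 * R\<^sup>2" if x': "x' \<in> sphere y R" for x'
      proof -
        \<comment> \<open>Translating back to the sphere about \<open>z\<close> costs less than
          \<open>d * R / 2\<close> at the sphere and again at the centre, which the extra slope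
          \<open>d\<close> absorbs.\<close>
        define x'' where "x'' = x' - y + z"
        have x'': "x'' \<in> sphere z R"
          using x' by (simp add: x''_def dist_norm norm_minus_commute)
        have dd: "dist x' x'' = dist y z" "dist y z < s"
          using y by (auto simp: x''_def dist_norm norm_minus_commute)
        have "dist (u x') (u x'') < d * R / 2"
          using x' x'' sub_cball dd s \<eta>(1) by (intro \<delta>(2)) auto
        moreover have "dist (u y) (u z) < d * R / 2"
          using y \<open>R > 0\<close> \<eta>(1) s dd by (intro \<delta>(2)) auto
        moreover have "u x'' \<le> u z + \<sigma> * R"
          using bd x'' by blast
        ultimately have "u x' \<le> u y + (\<sigma> + d) * R"
          unfolding dist_real_def distrib_right by linarith
        also have "(\<sigma> + d) * R = p * R + q / 2 * R\<^sup>2"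
          by (simp add: p_def power2_eq_square algebra_simps)
        finally show ?thesis by simp
      qed
    qed
    then have "u x - u y \<le> (p + q / 2 * dist x y) * dist x y"
      by (simp add: power2_eq_square algebra_simps)
    also have "\<dots> \<le> (\<sigma> - q * R / 2 + e) * dist x y"
    proof (rule mult_right_mono)
      have "dist x y \<le> 2 * s"
        using x y dist_triangle[of x y z] by (auto simp: dist_commute)
      have "q / 2 * dist x y \<le> \<bar>q\<bar> / 2 * (2 * s)"
        using \<open>dist x y \<le> 2 * s\<close> by (intro mult_mono) auto
      then show "p + q / 2 * dist x y \<le> \<sigma> - q * R / 2 + e"
        using d(3) qs by (simp add: p_def)
    qed auto
    finally show ?thesis .
  qed
  \<comment> \<open>Adding the estimate for one pair of points in both orders makes the left side
    vanish.\<close>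
  have "0 \<le> \<sigma> - q * R / 2 + e"
  proof -
    obtain b :: 'a where b: "norm b = s / 2"
      using vector_choose_size[of "s / 2"] s(1) by auto
    have "z + b \<in> ball z s" "z \<in> ball z s"
      using b s(1) by (auto simp: dist_norm)
    from lip[OF this] lip[OF this(2,1)]
    have "0 \<le> (\<sigma> - q * R / 2 + e) * s"
      using b by (simp add: dist_norm)
    then show ?thesis
      using s(1) by (simp add: zero_le_mult_iff)
  qed
  then show ?thesis
    using lip s(1) unfolding lip_consts_def by blast
qed

section \<open>Slopes along a step to the largest value on a sphere\<close>

lemma sphere_attains_max:
  fixes u :: "'a::euclidean_space \<Rightarrow> real"
  assumes "continuous_on B u" "cball z R \<subseteq> B" "R > 0"
  obtains y where "y \<in> sphere z R" "\<And>x. x \<in> sphere z R \<Longrightarrow> u x \<le> u y"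
proof -
  have "sphere z R \<subseteq> B"
    using assms(2) by auto
  then have "continuous_on (sphere z R) u"
    using assms(1) continuous_on_subset by blast
  then show ?thesis
    using continuous_attains_sup[of "sphere z R" u] assms(3) that by auto
qed

text \<open>Local Lipschitz continuity comes from comparison with cones: for \<open>q = 0\<close>
  the strictness condition reduces to \<open>0 < c\<close>.\<close>

lemma lip_consts_nonempty:
  fixes u :: "'a::euclidean_space \<Rightarrow> real"
  assumes sub: "radial_subsol B u c" and "open B" "z \<in> B" "c > 0"
  shows "lip_consts u z \<noteq> {}"
proof -
  obtain R where R: "R > 0" "cball z R \<subseteq> B"
    using assms(2,3) open_contains_cball by blast
  have "continuous_on B u"
    using sub by (simp add: radial_subsol_def)
  then obtain y where y: "\<And>x. x \<in> sphere z R \<Longrightarrow> u x \<le> u y"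
    using sphere_attains_max[OF _ R(2,1)] by metis
  have "(u y - u z) / R - 0 * R / 2 + 1 \<in> lip_consts u z"
    using R y \<open>c > 0\<close> by (intro lip_consts_radial[OF sub \<open>open B\<close>, where \<kappa> = 1]) auto
  then show ?thesis by blast
qed

text \<open>The radial comparison function bounds the slope from above at the centre, and from below at
  the boundary point where it touches \<open>u\<close>.\<close>

lemma local_lip_step:
  fixes u :: "'a::euclidean_space \<Rightarrow> real"
  assumes sub: "radial_subsol B u c" and B: "open B" "cball z R \<subseteq> B" and "R > 0"
    and y: "y \<in> sphere z R" "\<And>x. x \<in> sphere z R \<Longrightarrow> u x \<le> u y"
    and \<sigma>: "u y - u z = \<sigma> * R"
    and "\<kappa> > 0" and strict: "\<And>t. \<bar>t - \<sigma>\<bar> \<le> \<bar>q\<bar> * R / 2 + \<kappa> \<Longrightarrow> q * t\<^sup>2 < c"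
    and ne: "lip_consts u y \<noteq> {}"
  shows "local_lip u z \<le> \<sigma> - q * R / 2" "\<sigma> + q * R / 2 \<le> local_lip u y"
proof -
  have bd: "u x \<le> u z + \<sigma> * R" if "x \<in> sphere z R" for x
    using y(2)[OF that] \<sigma> by linarith
  show "local_lip u z \<le> \<sigma> - q * R / 2"
  proof (rule field_le_epsilon)
    fix e :: real assume "e > 0"
    from lip_consts_radial[OF sub B \<open>R > 0\<close> \<open>\<kappa> > 0\<close> strict bd this]
    show "local_lip u z \<le> \<sigma> - q * R / 2 + e"
      by (rule local_lip_le)
  qed
  show "\<sigma> + q * R / 2 \<le> local_lip u y"
  proof (rule local_lip_ge[OF ne])
    fix K assume "K \<in> lip_consts u y"
    then obtain r where r: "r > 0" "\<And>x x'. x \<in> ball y r \<Longrightarrow> x' \<in> ball y r \<Longrightarrow> u x - u x' \<le> K * dist x x'"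
      unfolding lip_consts_def by blast
    \<comment> \<open>With this \<open>p\<close> the comparison function touches \<open>u\<close> at
      \<open>y\<close>, where its radial slope is \<open>\<sigma> + q * R / 2\<close>.\<close>
    define p where "p = \<sigma> - q * R / 2"
    have cmp: "u x \<le> u z + p * dist x z + q / 2 * (dist x z)\<^sup>2" if "x \<in> cball z R" for x
    proof (rule radial_comparison[OF sub B(2) \<open>R > 0\<close> _ _ that])
      show "q * (p + q * t)\<^sup>2 < c" if "0 < t" "t < R" for t
      proof (rule strict)
        have "\<bar>p + q * t - \<sigma>\<bar> = \<bar>q\<bar> * \<bar>t - R / 2\<bar>"
          by (simp add: p_def algebra_simps flip: abs_mult)
        also have "\<dots> \<le> \<bar>q\<bar> * (R / 2)"
          using that by (intro mult_left_mono) linarith+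
        finally show "\<bar>p + q * t - \<sigma>\<bar> \<le> \<bar>q\<bar> * R / 2 + \<kappa>"
          using \<open>\<kappa> > 0\<close> by simp
      qed
      show "u x \<le> u z + p * R + q / 2 * R\<^sup>2" if "x \<in> sphere z R" for x
        using bd[OF that] by (simp add: p_def power2_eq_square algebra_simps)
    qed
    have ev: "p + q * R - q / 2 * t \<le> K" if t: "0 < t" "t < min r R" for t
    proof -
      \<comment> \<open>The point at distance \<open>t\<close> from \<open>y\<close> on the radius
        towards \<open>z\<close>; letting \<open>t\<close> tend to 0 recovers the boundary
        slope.\<close>
      define x where "x = y + (t / R) *\<^sub>R (z - y)"
      have dyz: "norm (z - y) = R"
        using y(1) by (simp add: dist_norm)
      have dxy: "dist y x = t"
        using t \<open>R > 0\<close> dyz by (simp add: x_def dist_norm)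
      have "x - z = (1 - t / R) *\<^sub>R (y - z)"
        by (simp add: x_def algebra_simps)
      then have "dist x z = (1 - t / R) * R"
        using t \<open>R > 0\<close> dyz by (simp add: dist_norm norm_minus_commute)
      then have dxz: "dist x z = R - t"
        using \<open>R > 0\<close> by (simp add: left_diff_distrib)
      have "u y - u x \<le> K * t"
        using r(2)[of y x] r(1) t dxy by auto
      moreover have "u x \<le> u z + p * (R - t) + q / 2 * (R - t)\<^sup>2"
        using cmp[of x] dxz t by (auto simp: dist_commute)
      moreover have "u y = u z + p * R + q / 2 * R\<^sup>2"
        using \<sigma> by (simp add: p_def power2_eq_square algebra_simps)
      ultimately have "(p + q * R - q / 2 * t) * t \<le> K * t"
        by (simp add: power2_eq_square algebra_simps)
      then show ?thesis
        using t by simp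
    qed
    have "\<forall>\<^sub>F t in at_right 0. p + q * R - q / 2 * t \<le> K"
      using ev r(1) \<open>R > 0\<close> by (auto simp: eventually_at_right_field intro!: exI[of _ "min r R"])
    moreover have "((\<lambda>t. p + q * R - q / 2 * t) \<longlongrightarrow> p + q * R - q / 2 * 0) (at_right 0)"
      by (intro tendsto_intros)
    ultimately have "p + q * R - q / 2 * 0 \<le> K"
      by (intro tendsto_upperbound) auto
    then show "\<sigma> + q * R / 2 \<le> K"
      by (simp add: p_def algebra_simps)
  qed
qed


section \<open>Strict sub- and supersolutions cannot coincide\<close>

text \<open>By the parallelogram law, two points of a sphere at nearly diametral distance are nearly
  opposite. Hence \<open>a\<close> and \<open>b\<close> both lie near the antipode of
  \<open>c\<close>.\<close>

lemma norm_diff_le_of_almost_antipodal: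
  fixes a b c m :: "'a::euclidean_space"
  assumes "dist a m = s" "dist b m = s" "dist c m = s" "s > 0" "\<mu> \<ge> 0" "\<eta> \<ge> 0"
    and "2 * \<mu> * s \<le> dist c a" "2 * \<mu> * s \<le> dist c b" "4 * (1 - \<mu>\<^sup>2) \<le> \<eta>\<^sup>2"
  shows "dist a b \<le> 2 * \<eta> * s"
proof -
  have *: "norm ((c - m) + (x - m)) \<le> \<eta> * s" if x: "dist x m = s" "2 * \<mu> * s \<le> dist c x" for x
  proof (rule power2_le_imp_le)
    have "(2 * \<mu> * s)\<^sup>2 \<le> (norm ((c - m) - (x - m)))\<^sup>2"
      using x(2) assms(4,5) by (intro power_mono) (auto simp: dist_norm)
    moreover have "(norm ((c - m) + (x - m)))\<^sup>2 + (norm ((c - m) - (x - m)))\<^sup>2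
        = 2 * (norm (c - m))\<^sup>2 + 2 * (norm (x - m))\<^sup>2"
      unfolding power2_norm_eq_inner by (simp add: algebra_simps inner_commute)
    moreover have "norm (c - m) = s" "norm (x - m) = s"
      using x(1) assms(3) by (auto simp: dist_norm)
    ultimately have "(norm ((c - m) + (x - m)))\<^sup>2 \<le> 4 * (1 - \<mu>\<^sup>2) * s\<^sup>2"
      by (simp add: power_mult_distrib algebra_simps)
    also have "\<dots> \<le> \<eta>\<^sup>2 * s\<^sup>2"
      using assms(9) by (intro mult_right_mono) auto
    finally show "(norm ((c - m) + (x - m)))\<^sup>2 \<le> (\<eta> * s)\<^sup>2"
      by (simp add: power_mult_distrib)
  qed (use assms in auto)
  have "dist a b = norm (((c - m) + (a - m)) - ((c - m) + (b - m)))"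
    by (simp add: dist_norm)
  also have "\<dots> \<le> norm ((c - m) + (a - m)) + norm ((c - m) + (b - m))"
    by (rule norm_triangle_ineq4)
  also have "\<dots> \<le> 2 * \<eta> * s"
    using *[of a] *[of b] assms by simp
  finally show ?thesis .
qed

lemma radial_subsol_strict_contradiction:
  fixes u :: "'a::euclidean_space \<Rightarrow> real"
  assumes B: "open B" "B \<noteq> {}" and ab: "0 < a" "a < b"
    and sub: "radial_subsol B u b" and sup: "radial_subsol B (\<lambda>x. - u x) (- a)"
  shows False
proof -
  let ?L = "local_lip u"
  have cont: "continuous_on B u"
    using sub by (simp add: radial_subsol_def)
  have ne: "lip_consts u z \<noteq> {}" if "z \<in> B" for z
    using lip_consts_nonempty[OF sub B(1) that] ab by linarith

  \<comment> \<open>A positive slope is needed to divide by \<open>\<Lambda>\<^sup>2\<close> later.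
    One step up with a small positive \<open>q\<close> produces it.\<close>
  obtain c0 where c0: "c0 \<in> B" "?L c0 > 0"
  proof -
    obtain z R where R: "R > 0" "cball z R \<subseteq> B"
      using B open_contains_cball by blast
    obtain y where y: "y \<in> sphere z R" "\<And>x. x \<in> sphere z R \<Longrightarrow> u x \<le> u y"
      using sphere_attains_max[OF cont R(2,1)] by metis
    define \<sigma> where "\<sigma> = (u y - u z) / R"
    define Q where "Q = \<bar>\<sigma>\<bar> + R / 2 + 1"
    define q where "q = min 1 (b / (2 * Q\<^sup>2))"
    have Q: "Q > 0"
      using R by (simp add: Q_def add_nonneg_pos)
    have q: "0 < q" "q \<le> 1" "q * Q\<^sup>2 < b"
    proof -
      show "0 < q" "q \<le> 1"
        using Q ab by (auto simp: q_def)
      have "q * Q\<^sup>2 \<le> b / (2 * Q\<^sup>2) * Q\<^sup>2"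
        by (intro mult_right_mono) (auto simp: q_def)
      then show "q * Q\<^sup>2 < b"
        using Q ab by simp
    qed
    have yB: "y \<in> B" "z \<in> B"
      using y(1) R by auto
    have st: "q * t\<^sup>2 < b" if t: "\<bar>t - \<sigma>\<bar> \<le> \<bar>q\<bar> * R / 2 + 1" for t
    proof -
      have "\<bar>q\<bar> * R \<le> 1 * R"
        using q R by (intro mult_right_mono) auto
      then have "\<bar>t\<bar> \<le> Q"
        using t unfolding Q_def by linarith
      then have "t\<^sup>2 \<le> Q\<^sup>2"
        using Q abs_le_square_iff[of t Q] by simp
      then have "q * t\<^sup>2 \<le> q * Q\<^sup>2"
        using q by (intro mult_left_mono) auto
      then show ?thesis
        using q by linarith
    qed
    have "u y - u z = \<sigma> * R"
      using R by (simp add: \<sigma>_def)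
    note step = local_lip_step[OF sub B(1) R(2,1) y this zero_less_one st ne[OF yB(1)]]
    have "?L y \<ge> q * R"
      using step local_lip_nonneg[OF ne[OF yB(2)]] by linarith
    then have "?L y > 0"
      using q(1) R(1) by (meson less_le_trans mult_pos_pos)
    then show ?thesis
      using that yB by blast
  qed
  obtain r where r: "r > 0" "cball c0 r \<subseteq> B"
    using B(1) c0(1) open_contains_cball by blast
  have ex_max: "\<exists>x\<in>cball c0 r. \<forall>y\<in>cball c0 r. ?L y - K * dist y c0 \<le> ?L x - K * dist x c0" for K
  proof (rule upper_semicontinuous_attains_sup)
    fix z c assume z: "z \<in> cball c0 r" and "?L z - K * dist z c0 < c"
    define e where "e = (c - (?L z - K * dist z c0)) / 2"
    have e: "e > 0"
      using \<open>_ < c\<close> by (simp add: e_def)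
    have "\<forall>\<^sub>F y in nhds z. ?L y < ?L z + e"
      using z r e by (intro local_lip_upper_semicontinuous ne) auto
    moreover have "((\<lambda>y. K * dist y c0) \<longlongrightarrow> K * dist z c0) (nhds z)"
      by (intro tendsto_intros) (simp add: filterlim_ident)
    then have "\<forall>\<^sub>F y in nhds z. K * dist z c0 - e < K * dist y c0"
      by (rule order_tendstoD) (use e in simp)
    ultimately show "\<forall>\<^sub>F y in nhds z. ?L y - K * dist y c0 < c"
    proof eventually_elim
      case (elim y)
      moreover have "?L z + e - (K * dist z c0 - e) = c"
        by (simp add: e_def field_simps)
      ultimately show ?case by linarith
    qed
  qed (use r in auto)
  obtain M where M: "\<And>y. y \<in> cball c0 r \<Longrightarrow> ?L y \<le> M" "M > 0"
  proof -
    obtain m where "\<And>y. y \<in> cball c0 r \<Longrightarrow> ?L y \<le> ?L m"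
      using ex_max[of 0] by (metis diff_zero mult_zero_left)
    moreover from this[of c0] have "?L m > 0"
      using c0 r by auto
    ultimately show ?thesis
      using that by blast
  qed
  \<comment> \<open>On the boundary of the ball the penalty equals \<open>M\<close>, which exceeds
    any possible gain over \<open>c0\<close>; the maximum point is therefore interior.\<close>
  define K where "K = M / r"
  have K: "K > 0"
    using M r by (simp add: K_def)
  obtain x where x: "x \<in> cball c0 r" "\<And>y. y \<in> cball c0 r \<Longrightarrow> ?L y - K * dist y c0 \<le> ?L x - K * dist x c0"
    using ex_max by blast
  define \<Lambda> where "\<Lambda> = ?L x"
  have x_gt: "?L c0 + K * dist x c0 \<le> \<Lambda>"
    using x(2)[of c0] r by (simp add: \<Lambda>_def)
  then have \<Lambda>: "\<Lambda> > 0"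
    using c0 K by (smt (verit) mult_nonneg_nonneg zero_le_dist)
  have x_ball: "x \<in> ball c0 r"
  proof (rule ccontr)
    assume "x \<notin> ball c0 r"
    then have "dist x c0 = r"
      using x(1) by (auto simp: dist_commute)
    then have "?L c0 + M \<le> \<Lambda>"
      using x_gt r by (simp add: K_def)
    then show False
      using M(1)[OF x(1)] c0 by (simp add: \<Lambda>_def)
  qed
  have L_le: "?L y \<le> \<Lambda> + K * dist y x" if "y \<in> cball c0 r" for y
  proof -
    have "?L y \<le> \<Lambda> + K * (dist y c0 - dist x c0)"
      using x(2)[OF that] by (simp add: \<Lambda>_def algebra_simps)
    also have "\<dots> \<le> \<Lambda> + K * dist y x"
      using K dist_triangle[of y c0 x] by (intro add_left_mono mult_left_mono) auto
    finally show ?thesis .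
  qed

  \<comment> \<open>\<open>q1 * \<Lambda>\<^sup>2\<close> and \<open>q2 * \<Lambda>\<^sup>2\<close>
    trisect the interval from \<open>a\<close> to \<open>b\<close>, so both strictness conditions
    hold with room near the slope \<Lambda>.\<close>
  define q1 where "q1 = (a + 2 * b) / (3 * \<Lambda>\<^sup>2)"
  define q2 where "q2 = (2 * a + b) / (3 * \<Lambda>\<^sup>2)"
  have q: "0 < q2" "q2 < q1" "q1 * \<Lambda>\<^sup>2 < b" "a < q2 * \<Lambda>\<^sup>2"
    using ab \<Lambda> by (auto simp: q1_def q2_def field_simps)
  \<comment> \<open>Makes \<open>K * (2 * \<eta> * s)\<close> half of the gain
    \<open>(q1 - q2) * s\<close>.\<close>
  define \<eta> where "\<eta> = (q1 - q2) / (4 * K)"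
  have \<eta>: "\<eta> > 0"
    using q K by (simp add: \<eta>_def)
  obtain \<kappa>0 where \<kappa>0: "\<kappa>0 > 0" "\<And>t. \<bar>t - \<Lambda>\<bar> \<le> \<kappa>0 \<Longrightarrow> q1 * t\<^sup>2 < b \<and> a < q2 * t\<^sup>2"
  proof -
    have lim: "((\<lambda>t. q1 * t\<^sup>2) \<longlongrightarrow> q1 * \<Lambda>\<^sup>2) (nhds \<Lambda>)" "((\<lambda>t. q2 * t\<^sup>2) \<longlongrightarrow> q2 * \<Lambda>\<^sup>2) (nhds \<Lambda>)"
      by (intro tendsto_intros; simp add: filterlim_ident)+
    have "\<forall>\<^sub>F t in nhds \<Lambda>. q1 * t\<^sup>2 < b \<and> a < q2 * t\<^sup>2"
      using order_tendstoD(2)[OF lim(1) q(3)] order_tendstoD(1)[OF lim(2) q(4)] by (rule eventually_conj)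
    then obtain d where "d > 0" "\<And>t. dist t \<Lambda> < d \<Longrightarrow> q1 * t\<^sup>2 < b \<and> a < q2 * t\<^sup>2"
      unfolding eventually_nhds_metric by auto
    then show ?thesis
      by (intro that[of "d / 2"]) (auto simp: dist_real_def)
  qed
  obtain \<kappa> where \<kappa>: "\<kappa> > 0" "\<kappa> \<le> \<kappa>0 / 4" "4 * (1 - (\<Lambda> / (\<Lambda> + \<kappa>))\<^sup>2) < \<eta>\<^sup>2"
  proof -
    have "((\<lambda>k. 4 * (1 - (\<Lambda> / (\<Lambda> + k))\<^sup>2)) \<longlongrightarrow> 4 * (1 - (\<Lambda> / (\<Lambda> + 0))\<^sup>2)) (at_right 0)"
      using \<Lambda> by (intro tendsto_intros) auto
    then have "\<forall>\<^sub>F k in at_right 0. 4 * (1 - (\<Lambda> / (\<Lambda> + k))\<^sup>2) < \<eta>\<^sup>2"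
      by (rule order_tendstoD(2)) (use \<Lambda> \<eta> in simp)
    then obtain d where d: "d > 0" "\<And>k. 0 < k \<Longrightarrow> k < d \<Longrightarrow> 4 * (1 - (\<Lambda> / (\<Lambda> + k))\<^sup>2) < \<eta>\<^sup>2"
      unfolding eventually_at_right_field by auto
    then show ?thesis
      using \<kappa>0(1) by (intro that[of "min (d / 2) (\<kappa>0 / 4)"]) (auto simp: min_def)
  qed
  have xB: "x \<in> B"
    using x(1) r by auto
  obtain \<delta> where \<delta>: "\<delta> > 0"
      "\<And>y z. y \<in> ball x \<delta> \<Longrightarrow> z \<in> ball x \<delta> \<Longrightarrow> u y - u z \<le> (\<Lambda> + \<kappa>) * dist y z"
    using local_lip_less_obtain[OF ne[OF xB], of "\<Lambda> + \<kappa>"] \<kappa>(1) unfolding \<Lambda>_def by (metis less_add_same_cancel1)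
  obtain \<rho> where \<rho>: "\<rho> > 0" "ball x \<rho> \<subseteq> ball c0 r"
    using x_ball open_ball open_contains_ball by blast
  \<comment> \<open>All points used stay where \<open>\<Lambda> + \<kappa>\<close> is a Lipschitz
    constant and inside the ball of the maximisation; the third entry keeps the slopes within
    \<kappa>0 of \<Lambda>.\<close>
  define s where "s = Min {\<delta> / 4, \<rho> / 4, \<kappa>0 / (4 * q1)}"
  have s: "s > 0" "4 * s \<le> \<delta>" "4 * s \<le> \<rho>" "q1 * s \<le> \<kappa>0 / 4"
  proof -
    have "s \<le> \<kappa>0 / (4 * q1)" "s \<le> \<delta> / 4" "s \<le> \<rho> / 4"
      unfolding s_def by (rule Min_le; simp)+
    then show "q1 * s \<le> \<kappa>0 / 4" "4 * s \<le> \<delta>" "4 * s \<le> \<rho>"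
      using q by (auto simp: field_simps)
    show "s > 0"
      using \<delta> \<rho> \<kappa>0 q by (auto simp: s_def)
  qed
  have near: "y \<in> ball x \<delta> \<and> y \<in> cball c0 r \<and> y \<in> B" if "dist y x \<le> 3 * s" for y
  proof -
    have "dist x y < 4 * s"
      using that s(1) by (simp add: dist_commute)
    then have "y \<in> ball x \<delta>" "y \<in> ball x \<rho>"
      using s by auto
    then show ?thesis
      using \<rho>(2) r(2) ball_subset_cball by blast
  qed
  have s_x: "cball x s \<subseteq> B"
    using near s(1) by (auto simp: dist_commute)

  obtain m where m: "m \<in> sphere x s" "\<And>y. y \<in> sphere x s \<Longrightarrow> u y \<le> u m"
    using sphere_attains_max[OF cont s_x s(1)] by metis
  have dm: "dist m x = s"
    using m(1) by (simp add: dist_commute)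
  have far: "dist y x \<le> 3 * s" if "dist m y \<le> s" for y
    using dist_triangle[of y x m] that dm s(1) by (simp add: dist_commute)
  have s_m: "cball m s \<subseteq> B"
    using near far by auto
  have mB: "m \<in> B"
    using s_m s(1) by auto
  have \<delta>_m: "x \<in> ball x \<delta>" "m \<in> ball x \<delta>"
    using near[of m] dm s(1) \<delta>(1) by auto
  define \<sigma> where "\<sigma> = (u m - u x) / s"
  have um: "u m - u x = \<sigma> * s"
    using s(1) by (simp add: \<sigma>_def)
  \<comment> \<open>Cone comparison, \<open>q = 0\<close>: the slope at the centre is at most the
    slope to the sphere maximum.\<close>
  have "\<Lambda> \<le> \<sigma>"
    using local_lip_step(1)[OF sub B(1) s_x s(1) m um zero_less_one, of 0] ne[OF mB] ab
    by (simp add: \<Lambda>_def)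
  moreover have "\<sigma> \<le> \<Lambda> + \<kappa>"
    using \<delta>(2)[OF \<delta>_m(2,1)] s(1) um dm by simp
  ultimately have "\<bar>\<sigma> - \<Lambda>\<bar> \<le> \<kappa>" "\<Lambda> \<le> \<sigma>"
    by auto
  have quarter: "\<kappa>0 / 4 > 0"
    using \<kappa>0(1) by simp
  have "q1 * t\<^sup>2 < b" if "\<bar>t - \<sigma>\<bar> \<le> \<bar>q1\<bar> * s / 2 + \<kappa>0 / 4" for t
  proof -
    have "\<bar>q1\<bar> * s \<le> \<kappa>0 / 4"
      using q s by auto
    then have "\<bar>t - \<Lambda>\<bar> \<le> \<kappa>0"
      using that \<open>\<bar>\<sigma> - \<Lambda>\<bar> \<le> \<kappa>\<close> \<kappa>(2) \<kappa>0(1) by linarith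
    then show ?thesis
      using \<kappa>0(2) by blast
  qed
  from local_lip_step[OF sub B(1) s_x s(1) m um quarter this ne[OF mB]]
  have Lm: "\<Lambda> + q1 * s \<le> ?L m"
    unfolding \<Lambda>_def by linarith

  \<comment> \<open>A second step up from \<open>m\<close> supplies a common near-antipode of
    \<open>x\<close> and \<open>y\<close> on the sphere about \<open>m\<close>.\<close>
  obtain w where w: "w \<in> sphere m s" "\<And>y. y \<in> sphere m s \<Longrightarrow> u y \<le> u w"
    using sphere_attains_max[OF cont s_m s(1)] by metis
  have wB: "w \<in> B"
    using w(1) s_m by auto
  have "?L m \<le> (u w - u m) / s"
    using local_lip_step(1)[OF sub B(1) s_m s(1) w _ zero_less_one, of "(u w - u m) / s" 0] ne[OF wB] ab s(1)
    by simp
  then have "?L m * s \<le> u w - u m"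
    using s(1) by (simp add: field_simps)
  moreover have "\<Lambda> * s \<le> ?L m * s"
    using Lm q s(1) by (intro mult_right_mono) (smt (verit) mult_pos_pos, simp)
  ultimately have uw: "\<Lambda> * s \<le> u w - u m"
    by linarith

  have cont': "continuous_on B (\<lambda>x. - u x)"
    using cont by (intro continuous_intros)
  obtain y where y: "y \<in> sphere m s" "\<And>z. z \<in> sphere m s \<Longrightarrow> - u z \<le> - u y"
    using sphere_attains_max[OF cont' s_m s(1)] by metis
  have yB: "y \<in> B"
    using y(1) s_m by auto
  have \<delta>_y: "y \<in> ball x \<delta>" "w \<in> ball x \<delta>"
    using near far y(1) w(1) by auto
  define \<tau> where "\<tau> = (u m - u y) / s"
  have uy: "- u y - - u m = \<tau> * s"
    using s(1) by (simp add: \<tau>_def)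
  \<comment> \<open>The starting point \<open>x\<close> competes in the step down from
    \<open>m\<close>, so that step is at least as steep as the step up.\<close>
  have "u y \<le> u x"
    using y(2)[of x] dm by simp
  then have "\<sigma> \<le> \<tau>"
    using s(1) by (simp add: \<sigma>_def \<tau>_def divide_right_mono)
  then have "\<Lambda> \<le> \<tau>"
    using \<open>\<Lambda> \<le> \<sigma>\<close> by linarith
  moreover have "\<tau> \<le> \<Lambda> + \<kappa>"
    using \<delta>(2)[OF \<delta>_m(2) \<delta>_y(1)] s(1) uy y(1) by simp
  ultimately have "\<bar>\<tau> - \<Lambda>\<bar> \<le> \<kappa>"
    by auto
  have "- q2 * t\<^sup>2 < - a" if "\<bar>t - \<tau>\<bar> \<le> \<bar>- q2\<bar> * s / 2 + \<kappa>0 / 4" for t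
  proof -
    have "\<bar>- q2\<bar> * s \<le> q1 * s"
      using q s by (intro mult_right_mono) auto
    then have "\<bar>t - \<Lambda>\<bar> \<le> \<kappa>0"
      using that \<open>\<bar>\<tau> - \<Lambda>\<bar> \<le> \<kappa>\<close> \<kappa>(2) \<kappa>0(1) s(4) by linarith
    then show ?thesis
      using \<kappa>0(2)[of t] by simp
  qed
  \<comment> \<open>A step down for \<open>u\<close> is a step up for \<open>- u\<close>, which has
    the same local Lipschitz constants; here \<open>- q2\<close> plays the part of
    \<open>q\<close>.\<close>
  from local_lip_step[OF sup B(1) s_m s(1) y uy quarter this] ne[OF yB]
  have "?L m \<le> \<tau> - - q2 * s / 2" "\<tau> + - q2 * s / 2 \<le> ?L y"
    unfolding local_lip_uminus lip_consts_uminus by blast+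
  then have Ly: "?L m - q2 * s \<le> ?L y"
    by simp

  \<comment> \<open>From \<open>w\<close> down to \<open>x\<close> or \<open>y\<close> the function
    drops by at least \<open>2 * \<Lambda> * s\<close>; the constant
    \<open>\<Lambda> + \<kappa>\<close> then forces a nearly diametral distance.\<close>
  have dist_x_y: "dist x y \<le> 2 * \<eta> * s"
  proof (rule norm_diff_le_of_almost_antipodal)
    let ?\<mu> = "\<Lambda> / (\<Lambda> + \<kappa>)"
    have *: "2 * ?\<mu> * s \<le> dist w z" if "z \<in> ball x \<delta>" "\<Lambda> * s \<le> u m - u z" for z
    proof -
      have "2 * \<Lambda> * s \<le> (\<Lambda> + \<kappa>) * dist w z"
        using \<delta>(2)[OF \<delta>_y(2) that(1)] uw that(2) by linarith
      then show ?thesis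
        using \<Lambda> \<kappa>(1) by (simp add: field_simps)
    qed
    have "\<Lambda> * s \<le> \<sigma> * s"
      using \<open>\<Lambda> \<le> \<sigma>\<close> s(1) by (intro mult_right_mono) auto
    then have "\<Lambda> * s \<le> u m - u x"
      using um by linarith
    then show "2 * ?\<mu> * s \<le> dist w x" "2 * ?\<mu> * s \<le> dist w y"
      using * \<delta>_m \<delta>_y \<open>u y \<le> u x\<close> by (smt (verit))+
    show "dist x m = s" "dist y m = s" "dist w m = s"
      using dm y(1) w(1) by (auto simp: dist_commute)
    show "0 < s" "0 \<le> ?\<mu>" "0 \<le> \<eta>" "4 * (1 - ?\<mu>\<^sup>2) \<le> \<eta>\<^sup>2"
      using s(1) \<Lambda> \<kappa> \<eta> by auto
  qed
  \<comment> \<open>The two steps gain \<open>(q1 - q2) * s\<close>, but maximality at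
    \<open>x\<close> permits only half of it.\<close>
  have "\<Lambda> + (q1 - q2) * s \<le> ?L y"
    using Lm Ly by (simp add: algebra_simps)
  also have "?L y \<le> \<Lambda> + K * dist y x"
    using near far y(1) by (intro L_le) auto
  also have "\<dots> \<le> \<Lambda> + K * (2 * \<eta> * s)"
    using dist_x_y K by (intro add_left_mono mult_left_mono) (auto simp: dist_commute)
  also have "\<dots> = \<Lambda> + (q1 - q2) * s / 2"
    using K by (simp add: \<eta>_def)
  finally have "(q1 - q2) * s \<le> 0"
    by (simp add: mult.commute)
  then show False
    using q s(1) by (simp add: mult_le_0_iff)
qed

section \<open>Viscosity solutions\<close>

text \<open>Polynomials in the squared distance are smooth at \<open>z\<close> too, hence admissible
  on all of \<Omega>. \<open>A\<close> is the derivative of the profile in the squared distance; the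
  Hessian is scalar plus rank one.\<close>

lemma C2_with_radial_quartic:
  fixes z :: "real^'n" and \<alpha> \<beta> t :: real
  defines "A \<equiv> \<lambda>x. \<alpha> + 2 * \<beta> * ((x - z) \<bullet> (x - z) - t)"
  shows "C2_with \<Omega> (\<lambda>x. \<alpha> * ((x - z) \<bullet> (x - z) - t) + \<beta> * ((x - z) \<bullet> (x - z) - t)\<^sup>2)
           (\<lambda>x. (2 * A x) *\<^sub>R (x - z))
           (\<lambda>x. \<chi> i j. (if i = j then 2 * A x else 0) + 8 * \<beta> * (x - z) $ i * (x - z) $ j)"
    and "(\<chi> i j. (if i = j then 2 * A x else 0) + 8 * \<beta> * (x - z) $ i * (x - z) $ j) *v h
           = (2 * A x) *\<^sub>R h + (8 * \<beta> * ((x - z) \<bullet> h)) *\<^sub>R (x - z)"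
proof -
  show mv: "(\<chi> i j. (if i = j then 2 * A x else 0) + 8 * \<beta> * (x - z) $ i * (x - z) $ j) *v h
           = (2 * A x) *\<^sub>R h + (8 * \<beta> * ((x - z) \<bullet> h)) *\<^sub>R (x - z)" for x h
  proof -
    define v where "v = x - z"
    have "(\<Sum>j\<in>UNIV. ((if i = j then 2 * A x else 0) + 8 * \<beta> * v $ i * v $ j) * h $ j)
        = (\<Sum>j\<in>UNIV. if i = j then 2 * A x * h $ j else 0) + (\<Sum>j\<in>UNIV. 8 * \<beta> * v $ i * (v $ j * h $ j))" for i
      unfolding sum.distrib[symmetric] by (intro sum.cong) (auto simp: algebra_simps)
    then show ?thesis
      unfolding v_def[symmetric]
      by (simp add: vec_eq_iff matrix_vector_mult_def inner_vec_def sum_distrib_left sum_distrib_right mult_ac)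
  qed
  show "C2_with \<Omega> (\<lambda>x. \<alpha> * ((x - z) \<bullet> (x - z) - t) + \<beta> * ((x - z) \<bullet> (x - z) - t)\<^sup>2)
           (\<lambda>x. (2 * A x) *\<^sub>R (x - z))
           (\<lambda>x. \<chi> i j. (if i = j then 2 * A x else 0) + 8 * \<beta> * (x - z) $ i * (x - z) $ j)"
    unfolding C2_with_def mv
  proof (intro conjI ballI)
    fix x
    show "((\<lambda>x. \<alpha> * ((x - z) \<bullet> (x - z) - t) + \<beta> * ((x - z) \<bullet> (x - z) - t)\<^sup>2) has_derivative
            (\<lambda>h. (2 * A x) *\<^sub>R (x - z) \<bullet> h)) (at x)"
      by (auto intro!: derivative_eq_intros simp: A_def fun_eq_iff inner_commute algebra_simps)
    show "((\<lambda>x. (2 * A x) *\<^sub>R (x - z)) has_derivative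
            (\<lambda>h. (2 * A x) *\<^sub>R h + (8 * \<beta> * ((x - z) \<bullet> h)) *\<^sub>R (x - z))) (at x)"
      unfolding A_def
      by (auto intro!: derivative_eq_intros simp: fun_eq_iff inner_commute algebra_simps)
  next
    show "continuous_on \<Omega> (\<lambda>x. \<chi> i j. (if i = j then 2 * A x else 0) + 8 * \<beta> * (x - z) $ i * (x - z) $ j)"
    proof (intro continuous_on_vec_lambda)
      fix i j
      show "continuous_on \<Omega> (\<lambda>x. (if i = j then 2 * A x else 0) + 8 * \<beta> * (x - z) $ i * (x - z) $ j)"
        unfolding A_def by (cases "i = j") (auto intro!: continuous_intros)
    qed
  qed
qed

text \<open>A quadratic function of the distance to \<open>z\<close> is singular at \<open>z\<close>, so it is replaced by a
  polynomial in the squared distance with the same first and a slightly larger second radial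
  derivative at the contact point.\<close>

lemma radial_subsol_of_visc_subsol:
  fixes \<Omega> :: "(real^'n) set"
  assumes sub: "inf_visc_subsol \<Omega> u h" and "B \<subseteq> \<Omega>" and h: "\<And>x. x \<in> B \<Longrightarrow> c \<le> h x"
  shows "radial_subsol B u c"
  unfolding radial_subsol_def
proof (intro conjI allI ballI impI)
  show "continuous_on B u"
    using sub assms(2) continuous_on_subset unfolding inf_visc_subsol_def by blast
next
  fix z p q x
  assume x: "x \<in> B - {z}"
    and touch: "\<forall>\<^sub>F y in nhds x. u y \<le> u x + p * (dist y z - dist x z) + q / 2 * (dist y z - dist x z)\<^sup>2"
  define r where "r = dist x z"
  have r: "r > 0"
    using x by (simp add: r_def)
  have main: "c \<le> (q + e) * p\<^sup>2" if e: "e > 0" for e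
  proof -
    \<comment> \<open>\<alpha> and \<beta> solve for radial slope \<open>p\<close> and second radial
      derivative \<open>q + e\<close> at radius \<open>r\<close>.\<close>
    define \<alpha> where "\<alpha> = p / (2 * r)"
    define \<beta> where "\<beta> = (q + e - 2 * \<alpha>) / (8 * r\<^sup>2)"
    have "8 * \<beta> * r\<^sup>2 = q + e - 2 * \<alpha>"
      using r by (simp add: \<beta>_def)
    then have pq: "p = 2 * \<alpha> * r" "q = 2 * \<alpha> + 8 * \<beta> * r\<^sup>2 - e"
      using r by (auto simp: \<alpha>_def)
    define \<phi> where "\<phi> y = \<alpha> * ((y - z) \<bullet> (y - z) - r\<^sup>2) + \<beta> * ((y - z) \<bullet> (y - z) - r\<^sup>2)\<^sup>2" for y
    have dz: "(y - z) \<bullet> (y - z) = (dist y z)\<^sup>2" for y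
      by (simp add: dist_norm power2_norm_eq_inner)
    have "((\<lambda>y. e / 2 + \<beta> * (4 * r * (dist y z - r) + (dist y z - r)\<^sup>2)) \<longlongrightarrow>
            e / 2 + \<beta> * (4 * r * (dist x z - r) + (dist x z - r)\<^sup>2)) (nhds x)"
      by (intro tendsto_intros) (simp_all add: filterlim_ident)
    then have "\<forall>\<^sub>F y in nhds x. 0 < e / 2 + \<beta> * (4 * r * (dist y z - r) + (dist y z - r)\<^sup>2)"
      by (rule order_tendstoD(1)) (use e in \<open>simp add: r_def\<close>)
    with touch have "\<forall>\<^sub>F y in nhds x. u y - \<phi> y \<le> u x - \<phi> x"
    proof eventually_elim
      case (elim y)
      define w where "w = dist y z - r"
      \<comment> \<open>Substituting \<open>2 * r * w + w\<^sup>2\<close> for the difference of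
        squared radii; near \<open>x\<close> the surplus \<open>e / 2\<close> dominates the cubic
        and quartic terms.\<close>
      have "\<phi> y = p * w + q / 2 * w\<^sup>2 + w\<^sup>2 * (e / 2 + \<beta> * (4 * r * w + w\<^sup>2))"
      proof -
        have "dist y z = r + w"
          by (simp add: w_def)
        then show ?thesis
          unfolding \<phi>_def dz pq by (simp add: field_simps power2_eq_square)
      qed
      moreover have "0 \<le> w\<^sup>2 * (e / 2 + \<beta> * (4 * r * w + w\<^sup>2))"
        using elim(2) by (intro mult_nonneg_nonneg) (auto simp: w_def)
      moreover have "\<phi> x = 0"
        unfolding \<phi>_def dz by (simp add: r_def)
      ultimately show ?case
        using elim(1) by (simp add: w_def r_def)
    qed
    then have "local_max_at \<Omega> (\<lambda>y. u y - \<phi> y) x"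
      unfolding local_max_at_def eventually_nhds_metric by (auto simp: dist_commute)
    moreover have "x \<in> \<Omega>"
      using x assms(2) by blast
    ultimately have "h x \<le> inf_lap ((2 * (\<alpha> + 2 * \<beta> * ((x - z) \<bullet> (x - z) - r\<^sup>2))) *\<^sub>R (x - z))
      (\<chi> i j. (if i = j then 2 * (\<alpha> + 2 * \<beta> * ((x - z) \<bullet> (x - z) - r\<^sup>2)) else 0)
         + 8 * \<beta> * (x - z) $ i * (x - z) $ j)"
      using sub C2_with_radial_quartic(1)[of \<Omega> \<alpha> z "r\<^sup>2" \<beta>]
      unfolding inf_visc_subsol_def \<phi>_def by blast
    also have "\<dots> = (2 * \<alpha> * r)\<^sup>2 * (2 * \<alpha> + 8 * \<beta> * r\<^sup>2)"
      unfolding inf_lap_def C2_with_radial_quartic(2)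
      by (simp add: inner_add_right dz flip: r_def) (simp add: power2_eq_square algebra_simps)
    also have "\<dots> = (q + e) * p\<^sup>2"
      unfolding pq by simp
    finally show ?thesis
      using h[of x] x by auto
  qed
  have "((\<lambda>e. (q + e) * p\<^sup>2) \<longlongrightarrow> (q + 0) * p\<^sup>2) (at_right 0)"
    by (intro tendsto_intros)
  moreover have "\<forall>\<^sub>F e in at_right 0. c \<le> (q + e) * p\<^sup>2"
    using main by (auto simp: eventually_at_right_field intro!: exI[of _ 1])
  ultimately have "c \<le> (q + 0) * p\<^sup>2"
    by (intro tendsto_lowerbound) auto
  then show "c \<le> q * p\<^sup>2"
    by simp
qed

section \<open>Sign symmetry and comparison of right-hand sides\<close>

lemma matrix_vector_mult_uminus:
  fixes A :: "real^'n^'m"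
  shows "(- A) *v x = - (A *v x)" "A *v (- x) = - (A *v x)"
  by (simp_all add: vec_eq_iff matrix_vector_mult_def sum_negf)

text \<open>The operator is cubic, hence odd, under a change of sign of the test function.\<close>

lemma inf_visc_subsol_uminus:
  fixes \<Omega> :: "(real^'n) set"
  assumes "inf_visc_supersol \<Omega> u h"
  shows "inf_visc_subsol \<Omega> (\<lambda>x. - u x) (\<lambda>x. - h x)"
  unfolding inf_visc_subsol_def
proof (intro conjI allI impI; (elim conjE)?)
  show "continuous_on \<Omega> (\<lambda>x. - u x)"
    using assms by (auto simp: inf_visc_supersol_def intro: continuous_intros)
next
  fix \<phi> D\<phi> H\<phi> x0
  assume C2: "C2_with \<Omega> \<phi> D\<phi> H\<phi>" and x0: "x0 \<in> \<Omega>" and "local_max_at \<Omega> (\<lambda>x. - u x - \<phi> x) x0"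
  then have min: "local_min_at \<Omega> (\<lambda>x. u x - - \<phi> x) x0"
    unfolding local_max_at_def local_min_at_def by (simp add: algebra_simps)
  have "C2_with \<Omega> (\<lambda>x. - \<phi> x) (\<lambda>x. - D\<phi> x) (\<lambda>x. - H\<phi> x)"
    using C2 unfolding C2_with_def matrix_vector_mult_uminus inner_minus_left
    by (auto intro: has_derivative_minus continuous_on_minus)
  then have "inf_lap (- D\<phi> x0) (- H\<phi> x0) \<le> h x0"
    using assms min x0 unfolding inf_visc_supersol_def by blast
  then show "- h x0 \<le> inf_lap (D\<phi> x0) (H\<phi> x0)"
    by (simp add: inf_lap_def matrix_vector_mult_uminus)
qed

lemma inf_visc_subsol_le_supersol:
  fixes \<Omega> :: "(real^'n) set"
  assumes "open \<Omega>" "continuous_on \<Omega> f" "continuous_on \<Omega> g"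
    and sub: "inf_visc_subsol \<Omega> u g" and sup: "inf_visc_supersol \<Omega> u f" and x: "x \<in> \<Omega>"
  shows "g x \<le> f x"
proof (rule ccontr)
  assume "\<not> g x \<le> f x"
  then have less: "f x < g x" by simp
  have sup': "inf_visc_subsol \<Omega> (\<lambda>x. - u x) (\<lambda>x. - f x)"
    by (rule inf_visc_subsol_uminus[OF sup])
  have nbhd: "\<exists>B. open B \<and> B \<noteq> {} \<and> radial_subsol B u b \<and> radial_subsol B (\<lambda>x. - u x) (- a)"
    if ab: "f x < a" "b < g x" for a b
  proof -
    define B where "B = (\<Omega> \<inter> f -` {..<a}) \<inter> (\<Omega> \<inter> g -` {b<..})"
    have "open B"
      unfolding B_def using assms(1-3) by (intro open_Int continuous_open_preimage) auto
    moreover have "x \<in> B"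
      using x ab by (simp add: B_def)
    moreover have "radial_subsol B u b"
      by (rule radial_subsol_of_visc_subsol[OF sub]) (auto simp: B_def)
    moreover have "radial_subsol B (\<lambda>x. - u x) (- a)"
      by (rule radial_subsol_of_visc_subsol[OF sup']) (auto simp: B_def)
    ultimately show ?thesis by blast
  qed
  show False
  proof (cases "g x > 0")
    case True
    \<comment> \<open>Cutting off at 0 makes the constants positive; \<open>a\<close> and
      \<open>b\<close> trisect the interval from \<open>m\<close> to \<open>g x\<close>.\<close>
    define m where "m = max (f x) 0"
    define a where "a = (2 * m + g x) / 3"
    define b where "b = (m + 2 * g x) / 3"
    have "f x < a" "b < g x" "0 < a" "a < b"
      using True less by (auto simp: a_def b_def m_def max_def)
    then show False
      using nbhd[of a b] radial_subsol_strict_contradiction by blast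
  next
    \<comment> \<open>Now \<open>f x < g x \<le> 0\<close>, so the constants are negative and
      \<open>- u\<close> has the positive constants \<open>- b < - a\<close>, with the two
      inequalities exchanged.\<close>
    case False
    define a where "a = (2 * f x + g x) / 3"
    define b where "b = (f x + 2 * g x) / 3"
    have ab: "f x < a" "b < g x" "0 < - b" "- b < - a"
      using False less by (auto simp: a_def b_def)
    then obtain B where B: "open B" "B \<noteq> {}" "radial_subsol B u b" "radial_subsol B (\<lambda>x. - u x) (- a)"
      using nbhd by blast
    then have "radial_subsol B (\<lambda>x. - (- u x)) (- (- b))"
      by simp
    then show False
      using radial_subsol_strict_contradiction[OF B(1,2) ab(3,4) B(4)] by blast
  qed
qed

theorem corollary3p2:
  fixes \<Omega> :: "(real^'n) set" and u f g :: "real^'n \<Rightarrow> real"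
  assumes "open \<Omega>"
    and "continuous_on \<Omega> u" and "continuous_on \<Omega> f" and "continuous_on \<Omega> g"
    and "inf_visc_sol \<Omega> u f" and "inf_visc_sol \<Omega> u g"
  shows "\<forall>x\<in>\<Omega>. f x = g x"
  using assms unfolding inf_visc_sol_def
  by (metis inf_visc_subsol_le_supersol order_antisym)

end
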